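(* Let $X_n,Y_n$ $(n\ge0)$ be the sequences defined in the context and let $\psi$ be the real root of $x^3=x^2+x+1$. Then $$\lim_{n\to\infty}\frac{Y_n}{X_n}=\psi .$$
   Context: $\operatorname{mex}(S)$ is the smallest nonnegative integer not in $S$. Set $X_0=Y_0=M_0=P_0=0$ and, for $n>0$, $X_n=\operatorname{mex}\{X_i,Y_i:i<n\}$, $M_n=\operatorname{mex}\{M_i,P_i:i<n\}$, $Y_n=X_n+M_n$, $P_n=X_n+Y_n$. The number $\psi=1.839286755214\ldots$ is the Tribonacci constant. *)

theory Defs
  imports Complex_Main
begin

definition mex :: "nat set \<Rightarrow> nat" where
  "mex S = (LEAST k. k \<notin> S)"

function seqX seqY seqM seqP :: "nat \<Rightarrow> nat" where
  "seqX n = (if n = 0 then 0 else mex (seqX ` {..<n} \<union> seqY ` {..<n}))"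
| "seqY n = (if n = 0 then 0 else seqX n + seqM n)"
| "seqM n = (if n = 0 then 0 else mex (seqM ` {..<n} \<union> seqP ` {..<n}))"
| "seqP n = (if n = 0 then 0 else seqX n + seqY n)"
  by pat_completeness auto
(* At equal index, Y depends on X and M, and P on X and Y. *)
termination
  by (relation "inv_image (less_than <*lex*> less_than)
        (\<lambda>s. case s of
           Inl (Inl n) \<Rightarrow> (n, 0::nat) | Inl (Inr n) \<Rightarrow> (n, 1)
         | Inr (Inl n) \<Rightarrow> (n, 0) | Inr (Inr n) \<Rightarrow> (n, 2))")
     auto

(* The defining equations loop when used as simplification rules. *)
declare seqX.simps [simp del] seqY.simps [simp del]
  seqM.simps [simp del] seqP.simps [simp del]

lemma ex1_tribonacci_root: "\<exists>!x::real. x ^ 3 = x ^ 2 + x + 1"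
proof -
  let ?f = "\<lambda>x::real. x ^ 3 - x ^ 2 - x - 1"
  have "\<exists>x\<ge>1. x \<le> 2 \<and> ?f x = 0"
    by (rule IVT') (auto intro!: continuous_intros)
  then obtain r :: real where r: "1 \<le> r" "r ^ 3 = r ^ 2 + r + 1"
    by auto
  show ?thesis
  proof (rule ex1I)
    show "r ^ 3 = r ^ 2 + r + 1" by (fact r)
  next
    fix x :: real
    assume x: "x ^ 3 = x ^ 2 + x + 1"
    have "(x - r) * (x^2 + (r - 1) * x + (r^2 - r - 1)) = 0"
      using r(2) x by (simp add: algebra_simps power2_eq_square power3_eq_cube)
    moreover have "x^2 + (r - 1) * x + (r^2 - r - 1) > 0"
    proof -
      have "r > 5/3"
      proof (rule ccontr)
        assume "\<not> r > 5/3"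
        then have "r * (r\<^sup>2 - r - 1) \<le> r * (1/9)"
          using r(1) mult_mono[of r "5/3" "r - 1" "2/3"]
          by (intro mult_left_mono) (auto simp: power2_eq_square algebra_simps)
        moreover have "r * (r\<^sup>2 - r - 1) = 1"
          using r(2) by (simp add: power2_eq_square power3_eq_cube algebra_simps)
        ultimately show False using \<open>\<not> r > 5/3\<close> by simp
      qed
      then have "3 * r\<^sup>2 - 2 * r - 5 > 0"
        using mult_strict_mono[of "5/3" r "3" "3 * r - 2"]
        by (simp add: power2_eq_square algebra_simps)
      moreover have "4 * (x^2 + (r - 1) * x + (r^2 - r - 1))
          = (2 * x + (r - 1))\<^sup>2 + (3 * r\<^sup>2 - 2 * r - 5)"
        by (simp add: power2_eq_square algebra_simps)
      ultimately have "4 * (x^2 + (r - 1) * x + (r^2 - r - 1)) > 0"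
        by (metis add_nonneg_pos zero_le_power2)
      then show ?thesis
        by (simp only: zero_less_mult_iff) auto
    qed
    ultimately show "x = r" by auto
  qed
qed

end

theory Submission imports Defs begin

text \<open>
  Both pairs \<open>(X, Y)\<close> and \<open>(M, P)\<close> are pairs of complementary increasing sequences. For such a pair
  \<open>(A, B)\<close>, counting the integers below \<open>A n\<close> shows that \<open>A n = n + k\<close>, where \<open>k\<close> is the
  number of positive indices \<open>i\<close> with \<open>B i < A n\<close>; thus \<open>B k \<le> A n \<le> B (k + 1)\<close>
  (lemma \<open>complementary_index\<close>). If \<open>B j\<close> is close to \<open>\<beta> j\<close>, then \<open>A n\<close> is close to
  \<open>\<beta> n / (\<beta> - 1)\<close>, with a smaller relative error (lemma \<open>complementary_error\<close>).

  Since \<open>Y = X + M\<close> and \<open>P = 2 X + M\<close>, bounds on the errors of \<open>X\<close> and \<open>M\<close> give bounds on those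
  of \<open>Y\<close> and \<open>P\<close>, and these give new bounds for \<open>X\<close> and \<open>M\<close>. The expected slopes are the fixed point
  \<open>\<alpha> = (\<psi> + 1) / \<psi>\<close>, \<open>\<mu> = (\<psi>\<^sup>2 - 1) / \<psi>\<close> of this process; the slopes of \<open>Y\<close> and \<open>P\<close> are then
  \<open>\<psi> + 1\<close> and \<open>\<psi>\<^sup>2 + 1\<close>, and consistency of the slopes is the equation
  \<open>\<psi>^3 = \<psi>^2 + \<psi> + 1\<close>. If the errors of \<open>X\<close> and \<open>M\<close> are measured with weights \<open>2\<close> and \<open>1\<close>, the
  process is a contraction up to additive constants (lemma \<open>error_contraction\<close>). Iterating it from
  trivial bounds yields \<open>X n / n \<longlonglongrightarrow> \<alpha>\<close> and \<open>M n / n \<longlonglongrightarrow> \<mu>\<close>, so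
  \<open>Y n / X n \<longlonglongrightarrow> (\<alpha> + \<mu>) / \<alpha> = \<psi>\<close>.
\<close>

section \<open>Minimal excluded values\<close>

lemma mex_notin:
  assumes "finite S"
  shows "mex S \<notin> S"
proof -
  obtain k where "k \<notin> S"
    using ex_new_if_finite[OF infinite_UNIV_nat assms] by blast
  then show ?thesis
    unfolding mex_def by (rule LeastI)
qed

lemma less_mex_in: "x < mex S \<Longrightarrow> x \<in> S"
  unfolding mex_def using not_less_Least by blast

lemma mex_le: "x \<notin> S \<Longrightarrow> mex S \<le> x"
  using less_mex_in not_le by blast

lemma mex_seq_strict_mono:
  fixes A B :: "nat \<Rightarrow> nat"
  assumes A0: "A 0 = 0"
    and A: "\<And>n. n > 0 \<Longrightarrow> A n = mex (A ` {..<n} \<union> B ` {..<n})"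
  shows "strict_mono A"
proof (rule strict_monoI)
  fix m n :: nat
  assume mn: "m < n"
  have new: "A n \<notin> A ` {..<n} \<union> B ` {..<n}"
    using A[of n] mex_notin[of "A ` {..<n} \<union> B ` {..<n}"] mn by simp
  then have ne: "A n \<noteq> A m"
    using mn by fastforce
  have "A m \<le> A n"
  proof (cases "m = 0")
    case True
    then show ?thesis by (simp add: A0)
  next
    case False
    have "A n \<notin> A ` {..<m} \<union> B ` {..<m}"
      using new mn by auto
    then show ?thesis
      using A[of m] False mex_le by simp
  qed
  then show "A m < A n"
    using ne by simp
qed

section \<open>Pairs of complementary sequences\<close>

lemma complementary_index:
  fixes A B :: "nat \<Rightarrow> nat"
  assumes A0: "A 0 = 0" and B0: "B 0 = 0"
    and A: "\<And>n. n > 0 \<Longrightarrow> A n = mex (A ` {..<n} \<union> B ` {..<n})"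
    and B: "strict_mono B"
    and AB: "\<And>n. n > 0 \<Longrightarrow> A n < B n"
  shows "\<exists>k. A n = n + k \<and> B k \<le> A n \<and> A n \<le> B (Suc k)"
proof (cases "n = 0")
  case True
  then show ?thesis
    using A0 B0 by (intro exI[of _ 0]) simp
next
  case False
  have monoA: "strict_mono A"
    using A0 A by (rule mex_seq_strict_mono)
  let ?I = "{i. 0 < i \<and> B i < A n}"
  have An: "A n > 0"
    using monoA False A0 by (metis neq0_conv strict_mono_less)
  have less: "i < A n" if "i \<in> ?I" for i
    using that strict_mono_imp_increasing[OF B, of i] by simp
  then have finI: "finite ?I"
    by (intro finite_subset[of ?I "{..<A n}"]) auto
  have eq: "{1..<A n} = A ` {1..<n} \<union> B ` ?I"
  proof (intro equalityI subsetI)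
    fix x
    assume x: "x \<in> {1..<A n}"
    then have "x \<in> A ` {..<n} \<union> B ` {..<n}"
      using A[of n] False by (intro less_mex_in) simp
    then obtain i where i: "i < n" "x = A i \<or> x = B i"
      by blast
    moreover have "i > 0"
      using i x A0 B0 by (cases i) auto
    ultimately show "x \<in> A ` {1..<n} \<union> B ` ?I"
      using x by auto
  next
    fix x
    assume "x \<in> A ` {1..<n} \<union> B ` ?I"
    then consider i where "0 < i" "i < n" "x = A i" | i where "0 < i" "B i < A n" "x = B i"
      by (fastforce simp: Suc_le_eq)
    then show "x \<in> {1..<A n}"
    proof cases
      case 1
      then show ?thesis
        using strict_monoD[OF monoA, of 0 i] strict_monoD[OF monoA, of i n] by simp
    next
      case 2
      then show ?thesis
        using strict_monoD[OF B, of 0 i] by simp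
    qed
  qed
  have disj: "A ` {1..<n} \<inter> B ` ?I = {}"
  proof -
    have "A i \<noteq> B j" if "0 < i" "0 < j" for i j
    proof (cases "j < i")
      case True
      have "A i \<notin> A ` {..<i} \<union> B ` {..<i}"
        using A[of i] mex_notin[of "A ` {..<i} \<union> B ` {..<i}"] that by simp
      then show ?thesis
        using True by auto
    next
      case False
      then have "B i \<le> B j"
        using B by (simp add: strict_mono_less_eq)
      then show ?thesis
        using AB[of i] that by simp
    qed
    then show ?thesis by auto
  qed
  have "card {1..<A n} = card (A ` {1..<n}) + card (B ` ?I)"
    unfolding eq using disj finI by (intro card_Un_disjoint) auto
  also have "\<dots> = (n - 1) + card ?I"
    using monoA B by (simp add: card_image strict_mono_on_imp_inj_on strict_mono_imp_inj_on)
  finally have cardA: "A n = n + card ?I"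
    using An False by simp
  define k where "k = card ?I"
  have "B k \<le> A n"
  proof (rule ccontr)
    assume "\<not> B k \<le> A n"
    then have neg: "A n < B k" by simp
    then have "i < k" if "i \<in> ?I" for i
      using that B strict_mono_less[OF B, of i k] by simp
    then have "?I \<subseteq> {1..<k}" by auto
    then have "card ?I \<le> card {1..<k}"
      by (intro card_mono) auto
    then show False
      using neg k_def B0 by (cases "k = 0") auto
  qed
  moreover have "A n \<le> B (Suc k)"
  proof (rule ccontr)
    assume neg: "\<not> A n \<le> B (Suc k)"
    have "{1..Suc k} \<subseteq> ?I"
    proof
      fix i assume i: "i \<in> {1..Suc k}"
      then have "B i \<le> B (Suc k)"
        using B by (simp add: strict_mono_less_eq)
      then show "i \<in> ?I"
        using neg i by simp
    qed
    then have "card {1..Suc k} \<le> card ?I"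
      using finI by (intro card_mono) auto
    then show False
      by (simp add: k_def)
  qed
  ultimately show ?thesis
    using cardA k_def by blast
qed

text \<open>
  The relative error \<open>s\<close> of \<open>B\<close> is passed on to \<open>A\<close> after division by \<open>(\<beta> - 1) (c - 1)\<close>: the factor
  \<open>c - 1\<close> is gained because the error of \<open>A\<close> at \<open>n\<close> comes from that of \<open>B\<close> at an index
  \<open>k \<le> n / (c - 1)\<close>.
\<close>

lemma complementary_error:
  fixes A B :: "nat \<Rightarrow> nat" and \<beta> c s C :: real
  assumes index: "\<exists>k. A n = n + k \<and> B k \<le> A n \<and> A n \<le> B (Suc k)"
    and err: "\<And>j. \<bar>real (B j) - \<beta> * real j\<bar> \<le> s * real j + C"
    and lower: "\<And>j. c * real j \<le> real (B j)"
    and \<beta>: "\<beta> > 1" and c: "c > 1" and s: "s \<ge> 0"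
  shows "\<bar>real (A n) - \<beta> / (\<beta> - 1) * real n\<bar>
    \<le> s / ((\<beta> - 1) * (c - 1)) * real n + (C + s + \<beta>) / (\<beta> - 1)"
proof -
  obtain k where k: "A n = n + k" "B k \<le> A n" "A n \<le> B (Suc k)"
    using index by blast
  have An: "real (A n) = real n + real k"
    using k(1) by simp
  have lo: "real (B k) \<le> real n + real k" and up: "real n + real k \<le> real (B (Suc k))"
    using k by simp_all
  have "(c - 1) * real k \<le> real n"
    using lower[of k] lo by (simp add: algebra_simps)
  then have kn: "real k \<le> real n / (c - 1)"
    using c by (simp add: field_simps)
  have "\<bar>(\<beta> - 1) * real k - real n\<bar> \<le> s * real k + (C + s + \<beta>)"
    using err[of k] err[of "Suc k"] lo up \<beta> s by (simp add: algebra_simps abs_le_iff)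
  also have "\<dots> \<le> s * (real n / (c - 1)) + (C + s + \<beta>)"
    using kn s by (intro add_right_mono mult_left_mono)
  finally have *: "\<bar>(\<beta> - 1) * real k - real n\<bar> \<le> s * (real n / (c - 1)) + (C + s + \<beta>)" .
  have "real (A n) - \<beta> / (\<beta> - 1) * real n = ((\<beta> - 1) * real k - real n) / (\<beta> - 1)"
    using \<beta> by (simp add: An field_simps)
  then have "\<bar>real (A n) - \<beta> / (\<beta> - 1) * real n\<bar> = \<bar>(\<beta> - 1) * real k - real n\<bar> / (\<beta> - 1)"
    using \<beta> by simp
  also have "\<dots> \<le> (s * (real n / (c - 1)) + (C + s + \<beta>)) / (\<beta> - 1)"
    using * \<beta> by (intro divide_right_mono) auto
  also have "\<dots> = s / ((\<beta> - 1) * (c - 1)) * real n + (C + s + \<beta>) / (\<beta> - 1)"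
    by (simp add: add_divide_distrib mult.commute)
  finally show ?thesis .
qed

section \<open>The four sequences\<close>

lemma seq_0 [simp]: "seqX 0 = 0" "seqY 0 = 0" "seqM 0 = 0" "seqP 0 = 0"
  by (simp_all add: seqX.simps[of 0] seqY.simps[of 0] seqM.simps[of 0] seqP.simps[of 0])

lemma seqX_mex: "n > 0 \<Longrightarrow> seqX n = mex (seqX ` {..<n} \<union> seqY ` {..<n})"
  by (subst seqX.simps) simp

lemma seqM_mex: "n > 0 \<Longrightarrow> seqM n = mex (seqM ` {..<n} \<union> seqP ` {..<n})"
  by (subst seqM.simps) simp

lemma seqY_eq: "seqY n = seqX n + seqM n"
  by (cases "n = 0") (simp_all add: seqY.simps[of n])

lemma seqP_eq: "seqP n = 2 * seqX n + seqM n"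
  by (cases "n = 0") (simp_all add: seqP.simps[of n] seqY_eq)

lemma strict_mono_seqX: "strict_mono seqX"
  by (rule mex_seq_strict_mono[OF _ seqX_mex]) simp_all

lemma strict_mono_seqM: "strict_mono seqM"
  by (rule mex_seq_strict_mono[OF _ seqM_mex]) simp_all

lemma seqX_ge: "n \<le> seqX n"
  by (rule strict_mono_imp_increasing[OF strict_mono_seqX])

lemma seqM_ge: "n \<le> seqM n"
  by (rule strict_mono_imp_increasing[OF strict_mono_seqM])

lemma seqX_index: "\<exists>k. seqX n = n + k \<and> seqY k \<le> seqX n \<and> seqX n \<le> seqY (Suc k)"
proof (rule complementary_index[OF _ _ seqX_mex])
  show "strict_mono seqY"
    using strict_mono_seqX strict_mono_seqM
    by (auto simp: strict_mono_def seqY_eq intro: add_strict_mono)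
  show "seqX m < seqY m" if "m > 0" for m
    using that seqM_ge[of m] by (simp add: seqY_eq)
qed simp_all

lemma seqM_index: "\<exists>k. seqM n = n + k \<and> seqP k \<le> seqM n \<and> seqM n \<le> seqP (Suc k)"
proof (rule complementary_index[OF _ _ seqM_mex])
  show "strict_mono seqP"
    using strict_mono_seqX strict_mono_seqM
    by (auto simp: strict_mono_def seqP_eq intro!: add_strict_mono)
  show "seqM m < seqP m" if "m > 0" for m
    using that seqX_ge[of m] by (simp add: seqP_eq)
qed simp_all

lemma seqX_le: "seqX n \<le> 2 * n"
proof -
  obtain k where "seqX n = n + k" "seqY k \<le> seqX n"
    using seqX_index by blast
  then show ?thesis
    using seqX_ge[of k] seqM_ge[of k] by (simp add: seqY_eq)
qed

lemma seqM_le: "seqM n \<le> 2 * n"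
proof -
  obtain k where "seqM n = n + k" "seqP k \<le> seqM n"
    using seqM_index by blast
  then show ?thesis
    using seqX_ge[of k] seqM_ge[of k] by (simp add: seqP_eq)
qed

section \<open>Contraction of the errors\<close>

lemma tribonacci_root_gt:
  fixes \<psi> :: real
  assumes "\<psi> ^ 3 = \<psi> ^ 2 + \<psi> + 1"
  shows "\<psi> > 9/5"
proof (rule ccontr)
  assume "\<not> \<psi> > 9/5"
  moreover have "(\<psi> + 2/5)\<^sup>2 + 7/25 \<ge> 0"
    by (simp add: add_nonneg_nonneg)
  ultimately have "(\<psi> - 9/5) * ((\<psi> + 2/5)\<^sup>2 + 7/25) \<le> 0"
    by (intro mult_nonpos_nonneg) auto
  moreover have "(\<psi> - 9/5) * ((\<psi> + 2/5)\<^sup>2 + 7/25) = 26/125"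
    using assms by (simp add: power2_eq_square power3_eq_cube field_simps)
  ultimately show False by simp
qed

text \<open>
  The new relative errors are at most \<open>3 e / \<psi>\<close> for \<open>X\<close> and \<open>5 e / (2 \<psi>\<^sup>2)\<close> for \<open>M\<close>; the
  weights \<open>2\<close> and \<open>1\<close> make both of them shrink. With equal weights the first would be
  \<open>2 e / \<psi> > e\<close>.
\<close>

lemma error_contraction:
  fixes \<psi> e C :: real
  defines "\<alpha> \<equiv> (\<psi> + 1) / \<psi>" and "\<mu> \<equiv> (\<psi>\<^sup>2 - 1) / \<psi>"
  assumes root: "\<psi> ^ 3 = \<psi> ^ 2 + \<psi> + 1" and e: "e \<ge> 0"
    and X: "\<And>n. \<bar>real (seqX n) - \<alpha> * real n\<bar> \<le> 2 * e * real n + C"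
    and M: "\<And>n. \<bar>real (seqM n) - \<mu> * real n\<bar> \<le> e * real n + C"
  shows "\<exists>C'. \<forall>n. \<bar>real (seqX n) - \<alpha> * real n\<bar> \<le> 2 * (5/6 * e) * real n + C' \<and>
    \<bar>real (seqM n) - \<mu> * real n\<bar> \<le> 5/6 * e * real n + C'"
proof -
  have psi: "\<psi> > 9/5"
    using root by (rule tribonacci_root_gt)
  have psi2: "\<psi>\<^sup>2 > 3"
    using mult_strict_mono[of "9/5" \<psi> "9/5" \<psi>] psi by (simp add: power2_eq_square)
  define CX where "CX = (2 * C + 3 * e + (\<psi> + 1)) / \<psi>"
  define CM where "CM = (3 * C + 5 * e + (\<psi>\<^sup>2 + 1)) / \<psi>\<^sup>2"
  have slopeY: "\<alpha> + \<mu> = \<psi> + 1"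
    using psi by (simp add: \<alpha>_def \<mu>_def field_simps power2_eq_square)
  have slopeP: "2 * \<alpha> + \<mu> = \<psi>\<^sup>2 + 1"
    using psi root by (simp add: \<alpha>_def \<mu>_def field_simps power2_eq_square power3_eq_cube)
  have "(\<psi>\<^sup>2 + 1) * \<psi> = (\<psi>\<^sup>2 - 1) * \<psi>\<^sup>2"
  proof -
    have "\<psi> ^ 4 = \<psi> * (\<psi> ^ 2 + \<psi> + 1)"
      using root by (simp add: power4_eq_xxxx power3_eq_cube)
    then show ?thesis
      using root by (simp add: power4_eq_xxxx power3_eq_cube power2_eq_square algebra_simps)
  qed
  then have slopeM: "(\<psi>\<^sup>2 + 1) / (\<psi>\<^sup>2 + 1 - 1) = \<mu>"
    using psi by (simp add: \<mu>_def field_simps)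
  have Y: "\<bar>real (seqY j) - (\<psi> + 1) * real j\<bar> \<le> 3 * e * real j + 2 * C" for j
    unfolding slopeY[symmetric] using X[of j] M[of j]
    by (simp add: seqY_eq abs_le_iff algebra_simps)
  have P: "\<bar>real (seqP j) - (\<psi>\<^sup>2 + 1) * real j\<bar> \<le> 5 * e * real j + 3 * C" for j
    unfolding slopeP[symmetric] using X[of j] M[of j]
    by (simp add: seqP_eq abs_le_iff algebra_simps)
  have X': "\<bar>real (seqX n) - \<alpha> * real n\<bar> \<le> 2 * (5/6 * e) * real n + CX" for n
  proof -
    have "2 * real j \<le> real (seqY j)" for j
      using seqX_ge[of j] seqM_ge[of j] by (simp add: seqY_eq)
    then have "\<bar>real (seqX n) - \<alpha> * real n\<bar> \<le> 3 * e / \<psi> * real n + CX"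
      using complementary_error[where A = seqX and B = seqY and n = n and c = 2
        and \<beta> = "\<psi> + 1" and s = "3 * e" and C = "2 * C", OF seqX_index Y] psi e
      by (simp add: CX_def \<alpha>_def)
    moreover have "3 * e / \<psi> \<le> 2 * (5/6 * e)"
      using psi e mult_left_mono[of "9/5" \<psi> e] by (simp add: field_simps)
    ultimately show ?thesis
      by (smt (verit) mult_right_mono of_nat_0_le_iff)
  qed
  have M': "\<bar>real (seqM n) - \<mu> * real n\<bar> \<le> 5/6 * e * real n + CM" for n
  proof -
    have "3 * real j \<le> real (seqP j)" for j
      using seqX_ge[of j] seqM_ge[of j] by (simp add: seqP_eq)
    then have "\<bar>real (seqM n) - \<mu> * real n\<bar> \<le> 5 * e / (\<psi>\<^sup>2 * 2) * real n + CM"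
      using complementary_error[where A = seqM and B = seqP and n = n and c = 3
        and \<beta> = "\<psi>\<^sup>2 + 1" and s = "5 * e" and C = "3 * C", OF seqM_index P] psi psi2 e
      by (simp add: CM_def slopeM[symmetric])
    moreover have "5 * e / (\<psi>\<^sup>2 * 2) \<le> 5/6 * e"
      using psi psi2 e mult_left_mono[of 3 "\<psi>\<^sup>2" e] by (simp add: field_simps)
    ultimately show ?thesis
      by (smt (verit) mult_right_mono of_nat_0_le_iff)
  qed
  show ?thesis
    using X' M' by (intro exI[of _ "max CX CM"]) (smt (verit) max.cobounded1 max.cobounded2)
qed

text \<open>The starting error \<open>\<alpha> + \<mu> + 2\<close> comes from \<open>0 \<le> X n \<le> 2 n\<close> and \<open>0 \<le> M n \<le> 2 n\<close>.\<close>

lemma error_bounds: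
  fixes \<psi> :: real
  defines "\<alpha> \<equiv> (\<psi> + 1) / \<psi>" and "\<mu> \<equiv> (\<psi>\<^sup>2 - 1) / \<psi>"
  assumes root: "\<psi> ^ 3 = \<psi> ^ 2 + \<psi> + 1"
  shows "\<exists>C. \<forall>n. \<bar>real (seqX n) - \<alpha> * real n\<bar> \<le> 2 * ((5/6) ^ i * (\<alpha> + \<mu> + 2)) * real n + C \<and>
    \<bar>real (seqM n) - \<mu> * real n\<bar> \<le> (5/6) ^ i * (\<alpha> + \<mu> + 2) * real n + C"
proof (induction i)
  case 0
  have pos: "\<alpha> \<ge> 0" "\<mu> \<ge> 0"
    using tribonacci_root_gt[OF root] by (simp_all add: \<alpha>_def \<mu>_def)
  show ?case
  proof (intro exI[of _ 0] allI conjI)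
    fix n
    have "real (seqX n) \<le> 2 * real n" "real (seqM n) \<le> 2 * real n"
      using seqX_le[of n] seqM_le[of n] by linarith+
    moreover have "0 \<le> \<alpha> * real n" "0 \<le> \<mu> * real n"
      using pos by simp_all
    ultimately show
      "\<bar>real (seqX n) - \<alpha> * real n\<bar> \<le> 2 * ((5/6) ^ 0 * (\<alpha> + \<mu> + 2)) * real n + 0"
      "\<bar>real (seqM n) - \<mu> * real n\<bar> \<le> (5/6) ^ 0 * (\<alpha> + \<mu> + 2) * real n + 0"
      by (simp_all add: abs_le_iff algebra_simps)
  qed
next
  case (Suc i)
  have "\<alpha> + \<mu> + 2 \<ge> 0"
    using tribonacci_root_gt[OF root] by (simp add: \<alpha>_def \<mu>_def)
  then have e: "(5/6) ^ i * (\<alpha> + \<mu> + 2) \<ge> 0"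
    by simp
  show ?case
    using Suc.IH error_contraction[OF root e] unfolding \<alpha>_def \<mu>_def
    by (auto simp: mult.assoc)
qed

section \<open>Limits\<close>

lemma tendsto_slope:
  fixes a :: "nat \<Rightarrow> real" and \<alpha> K q :: real
  assumes err: "\<And>i. \<exists>C. \<forall>n. \<bar>a n - \<alpha> * real n\<bar> \<le> K * q ^ i * real n + C"
    and q: "0 \<le> q" "q < 1"
  shows "(\<lambda>n. a n / real n) \<longlonglongrightarrow> \<alpha>"
proof (rule LIMSEQ_I)
  fix r :: real
  assume r: "r > 0"
  have "(\<lambda>i. K * q ^ i) \<longlonglongrightarrow> K * 0"
    using q by (intro tendsto_mult tendsto_const LIMSEQ_power_zero) simp
  then have "eventually (\<lambda>i. K * q ^ i < r / 2) sequentially"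
    using r by (intro order_tendstoD(2)) auto
  then obtain i where i: "K * q ^ i < r / 2"
    by (auto simp: eventually_sequentially)
  obtain C where C: "\<And>n. \<bar>a n - \<alpha> * real n\<bar> \<le> K * q ^ i * real n + C"
    using err[of i] by blast
  obtain N :: nat where N: "2 * C / r < real N"
    using reals_Archimedean2 by blast
  show "\<exists>no. \<forall>n\<ge>no. norm (a n / real n - \<alpha>) < r"
  proof (intro exI[of _ "Suc N"] allI impI)
    fix n
    assume n: "n \<ge> Suc N"
    then have n0: "real n > 0" by simp
    have "2 * C / r < real n"
      using N n by simp
    then have "C < r / 2 * real n"
      using r by (simp add: field_simps)
    moreover have "K * q ^ i * real n \<le> r / 2 * real n"
      using i n0 by (intro mult_right_mono) auto
    ultimately have "\<bar>a n - \<alpha> * real n\<bar> < r * real n"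
      using C[of n] by simp
    moreover have "a n / real n - \<alpha> = (a n - \<alpha> * real n) / real n"
      using n0 by (simp add: field_simps)
    ultimately show "norm (a n / real n - \<alpha>) < r"
      using n0 by (simp add: field_simps)
  qed
qed

theorem mainTheorem5:
  fixes \<psi> :: real
  assumes "\<psi> ^ 3 = \<psi> ^ 2 + \<psi> + 1"
  shows "(\<lambda>n. real (seqY n) / real (seqX n)) \<longlonglongrightarrow> \<psi>"
proof -
  define \<alpha> where "\<alpha> = (\<psi> + 1) / \<psi>"
  define \<mu> where "\<mu> = (\<psi>\<^sup>2 - 1) / \<psi>"
  note bounds = error_bounds[OF assms, folded \<alpha>_def \<mu>_def]
  have psi: "\<psi> > 9/5"
    using assms by (rule tribonacci_root_gt)
  have X: "(\<lambda>n. real (seqX n) / real n) \<longlonglongrightarrow> \<alpha>"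
  proof (rule tendsto_slope)
    show "\<exists>C. \<forall>n. \<bar>real (seqX n) - \<alpha> * real n\<bar>
        \<le> 2 * (\<alpha> + \<mu> + 2) * (5/6) ^ i * real n + C" for i
      using bounds[of i] by (simp only: mult_ac) blast
  qed simp_all
  have M: "(\<lambda>n. real (seqM n) / real n) \<longlonglongrightarrow> \<mu>"
  proof (rule tendsto_slope)
    show "\<exists>C. \<forall>n. \<bar>real (seqM n) - \<mu> * real n\<bar>
        \<le> (\<alpha> + \<mu> + 2) * (5/6) ^ i * real n + C" for i
      using bounds[of i] by (simp only: mult_ac) blast
  qed simp_all
  have "\<alpha> > 0"
    using psi by (simp add: \<alpha>_def)
  then have "(\<lambda>n. (real (seqX n) / real n + real (seqM n) / real n) / (real (seqX n) / real n))
      \<longlonglongrightarrow> (\<alpha> + \<mu>) / \<alpha>"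
    by (intro tendsto_divide tendsto_add X M) simp
  moreover have "(\<alpha> + \<mu>) / \<alpha> = \<psi>"
  proof -
    have "\<alpha> + \<mu> = \<psi> * \<alpha>"
      using psi by (simp add: \<alpha>_def \<mu>_def field_simps power2_eq_square)
    then show ?thesis
      using \<open>\<alpha> > 0\<close> by simp
  qed
  moreover have "(real (seqX n) / real n + real (seqM n) / real n) / (real (seqX n) / real n)
      = real (seqY n) / real (seqX n)" for n
    by (cases "n = 0") (simp_all add: seqY_eq add_divide_distrib[symmetric])
  ultimately show ?thesis
    by (simp only:)
qed

end
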